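(* Write positions of the game CircularNim $\mathrm{CN}(7,3)$ as $\boldsymbol{p}=(a,b,c,d,e,f,g)$, listed in cyclic order. Then, up to rotation and reflection of positions, the set of $\mathcal{P}$-positions of $\mathrm{CN}(7,3)$ is $$\mathcal{P}_{7,3}=\{\boldsymbol{p}\mid a=\min(\boldsymbol{p}),\ b\le g,\ a+b=e+\min(d,f),\ b+c+d=e+f+g\}.$$ That is, a position is a $\mathcal{P}$-position of $\mathrm{CN}(7,3)$ if and only if some rotation or reflection (element of the dihedral group of the 7-cycle) of it belongs to the displayed set.
   Context: CircularNim $\mathrm{CN}(n,k)$ is played on $n$ stacks of tokens arranged in a circle. A position is a vector of $n$ non-negative integers (stack heights in cyclic order). In each move a player selects $k$ consecutive stacks (cyclically) and removes at least one token in total from these $k$ stacks (any number of tokens may be removed from each selected stack, including none, as long as at least one token is removed overall). Two players alternate, and the last player to move wins. An $\mathcal{N}$-position is one from which the player about to move can win with optimal play; a $\mathcal{P}$-position is one from which the player about to move loses against optimal play. $\min(\boldsymbol{p})$ denotes the minimum stack height of $\boldsymbol{p}$. Positions of CircularNim are considered only up to rotation and reflection. *)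

theory Defs
  imports Main
begin

text \<open>Stacks of a position are listed in cyclic order, indices being read modulo the number \<open>n\<close>
  of stacks.\<close>

definition window :: "nat \<Rightarrow> nat \<Rightarrow> nat \<Rightarrow> nat set" where
  "window n k i = {(i + l) mod n | l. l < k}"

definition cn_move :: "nat \<Rightarrow> nat \<Rightarrow> nat list \<Rightarrow> nat list \<Rightarrow> bool" where
  "cn_move n k p q \<longleftrightarrow> length p = n \<and> length q = n \<and>
     (\<exists>i<n. (\<forall>j<n. j \<notin> window n k i \<longrightarrow> q ! j = p ! j) \<and>
            (\<forall>j\<in>window n k i. q ! j \<le> p ! j) \<and>
            (\<exists>j\<in>window n k i. q ! j < p ! j))"

text \<open>Outcome classes under normal play, by backward induction: the least fixed point says that
  the player about to move (respectively the opponent) can force a win in finitely many moves.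
  A player without a move has lost, so a terminal position is a \<open>\<P>\<close>-position.\<close>

inductive N_position :: "('p \<Rightarrow> 'p \<Rightarrow> bool) \<Rightarrow> 'p \<Rightarrow> bool"
  and P_position :: "('p \<Rightarrow> 'p \<Rightarrow> bool) \<Rightarrow> 'p \<Rightarrow> bool"
  for move :: "'p \<Rightarrow> 'p \<Rightarrow> bool" where
  N_positionI: "move p q \<Longrightarrow> P_position move q \<Longrightarrow> N_position move p"
| P_positionI: "(\<And>q. move p q \<Longrightarrow> N_position move q) \<Longrightarrow> P_position move p"

definition dihedral_orbit :: "'a list \<Rightarrow> 'a list set" where
  "dihedral_orbit p = {rotate m p | m. True} \<union> {rotate m (rev p) | m. True}"

definition P73 :: "nat list set" where
  "P73 = {[a, b, c, d, e, f, g] | a b c d e f g.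
     a = Min {a, b, c, d, e, f, g} \<and> b \<le> g \<and>
     a + b = e + min d f \<and> b + c + d = e + f + g}"

end

theory Submission
  imports Defs
begin

text \<open>The moves of the game terminate, so a set of positions that no move connects to itself and that is
reachable in one move from everywhere outside is the set of \<open>\<P>\<close>-positions
(\<open>P_position_iff_kernel\<close>). It remains to see that the orbit of \<open>P73\<close> is such a kernel.

Membership in \<open>P73\<close> only depends on the heights above the stack \<open>a\<close> of minimal height, the centre.
Up to the reflection that fixes the centre it says that the two triples \<open>b, c, d\<close> and \<open>g, f, e\<close>
beside the centre have the same sum, that \<open>a + b \<le> e + f\<close> and \<open>a + min b g \<le> d + e\<close>, and that
one of these inequalities is tight. This predicate \<open>balanced\<close> is invariant under the reflection
and under adding a constant to all stacks, and it consists of linear conditions. A position lies in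
the orbit of \<open>P73\<close> iff it is balanced around one of its seven stacks.

Independence (\<open>has_balance_descent\<close>): let one position be balanced around the stack \<open>0\<close> and
a position below it, differing in three consecutive stacks only, be balanced around the stack
\<open>j\<close>. For each \<open>j\<close> and each choice of the three stacks this is a system of linear inequalities
which forces the two positions to have the same total, hence to coincide. The reflection reduces
\<open>j\<close> to \<open>0, 1, 2, 3\<close>.

Absorption (\<open>descent_to_balanced\<close>): from every position one can lower at most three consecutive
stacks and obtain a position balanced around the same minimal stack. Subtracting the minimum makes
the centre empty, and the reflection gives \<open>b \<le> g\<close>. If \<open>b\<close> is small compared with \<open>e + min d f\<close>,
then \<open>b\<close> is kept and the other stacks are lowered so as to split \<open>b\<close> into two adjacent
heights; if \<open>b\<close> is large, it is usually \<open>b\<close> that is lowered, to \<open>e + min d f\<close>. In both cases one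
further stack is lowered to make the two triples equal in sum. From a position outside the kernel,
the position so reached is a different one, so that a legal move has been made.\<close>

section \<open>Kernels of terminating games\<close>

text \<open>Rule induction shows that winning positions avoid the kernel and losing positions belong to it;
the converse needs the measure, because the outcome predicates are least fixed points and leave
positions with infinite plays undecided.\<close>
lemma P_position_iff_kernel:
  fixes size_of :: "'p \<Rightarrow> nat"
  assumes decreasing: "\<And>p q. move p q \<Longrightarrow> size_of q < size_of p"
    and closed: "\<And>p q. p \<in> S \<Longrightarrow> move p q \<Longrightarrow> q \<in> S"
    and independent: "\<And>p q. p \<in> S \<Longrightarrow> K p \<Longrightarrow> move p q \<Longrightarrow> \<not> K q"
    and absorbing: "\<And>p. p \<in> S \<Longrightarrow> \<not> K p \<Longrightarrow> \<exists>q. move p q \<and> K q"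
    and p: "p \<in> S"
  shows "P_position move p \<longleftrightarrow> K p"
proof
  have "(N_position move p \<longrightarrow> p \<in> S \<longrightarrow> \<not> K p) \<and> (P_position move p \<longrightarrow> p \<in> S \<longrightarrow> K p)"
    by (induction rule: N_position_P_position.induct) (use closed independent absorbing in blast)+
  then show "K p" if "P_position move p"
    using that p by blast
next
  have "(K p \<longrightarrow> P_position move p) \<and> (\<not> K p \<longrightarrow> N_position move p)"
    using p
  proof (induction "size_of p" arbitrary: p rule: less_induct)
    case less
    show ?case
      by (metis N_positionI P_positionI absorbing closed decreasing independent less)
  qed
  then show "P_position move p" if "K p"
    using that by blast
qed

section \<open>Moves on seven stacks\<close>

text \<open>This is the move relation together with equality: the four stacks outside some window of three
consecutive ones are unchanged. Integers are used so that a constant can be subtracted from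
all heights.\<close>
definition descent ::
    "int \<Rightarrow> int \<Rightarrow> int \<Rightarrow> int \<Rightarrow> int \<Rightarrow> int \<Rightarrow> int \<Rightarrow> int \<Rightarrow> int \<Rightarrow> int \<Rightarrow> int \<Rightarrow> int \<Rightarrow> int \<Rightarrow> int \<Rightarrow> bool" where
  "descent a b c d e f g A B C D E F G \<longleftrightarrow>
     A \<le> a \<and> B \<le> b \<and> C \<le> c \<and> D \<le> d \<and> E \<le> e \<and> F \<le> f \<and> G \<le> g \<and>
     (D = d \<and> E = e \<and> F = f \<and> G = g \<or> A = a \<and> E = e \<and> F = f \<and> G = g \<or>
      A = a \<and> B = b \<and> F = f \<and> G = g \<or> A = a \<and> B = b \<and> C = c \<and> G = g \<or>
      A = a \<and> B = b \<and> C = c \<and> D = d \<or> B = b \<and> C = c \<and> D = d \<and> E = e \<or>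
      C = c \<and> D = d \<and> E = e \<and> F = f)"

lemma descent_rotate:
  "descent a b c d e f g A B C D E F G \<longleftrightarrow> descent b c d e f g a B C D E F G A"
  unfolding descent_def by (smt (verit))

lemma descent_reflect:
  "descent a b c d e f g A B C D E F G \<longleftrightarrow> descent a g f e d c b A G F E D C B"
  unfolding descent_def by (smt (verit))

lemma descent_translate:
  "descent (a - t) (b - t) (c - t) (d - t) (e - t) (f - t) (g - t) A B C D E F G \<longleftrightarrow>
   descent a b c d e f g (A + t) (B + t) (C + t) (D + t) (E + t) (F + t) (G + t)"
  unfolding descent_def by (simp add: le_diff_eq eq_diff_eq)

lemma bex_lessThan_7: "(\<exists>i<7. Q i) \<longleftrightarrow> Q 0 \<or> Q 1 \<or> Q 2 \<or> Q 3 \<or> Q 4 \<or> Q 5 \<or> Q (6 :: nat)"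
proof -
  have "(\<exists>i<7. Q i) \<longleftrightarrow> (\<exists>i\<in>{..<7}. Q i)"
    by auto
  also have "{..<7 :: nat} = {0, 1, 2, 3, 4, 5, 6}"
    by auto
  finally show ?thesis
    by simp
qed

lemma ball_lessThan_7: "(\<forall>i<7. Q i) \<longleftrightarrow> Q 0 \<and> Q 1 \<and> Q 2 \<and> Q 3 \<and> Q 4 \<and> Q 5 \<and> Q (6 :: nat)"
  using bex_lessThan_7[of "\<lambda>i. \<not> Q i"] by blast

lemma window_7_3: "window 7 3 i = {i mod 7, (i + 1) mod 7, (i + 2) mod 7}"
proof -
  have "window 7 3 i = (\<lambda>l. (i + l) mod 7) ` {..<3}"
    unfolding window_def by auto
  also have "{..<3 :: nat} = {0, 1, 2}"
    by auto
  finally show ?thesis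
    by simp
qed

lemma cn_move_iff_weak_move:
  "cn_move n k p q \<longleftrightarrow> length p = n \<and> length q = n \<and> (\<forall>j<n. q ! j \<le> p ! j) \<and>
     (\<exists>i<n. \<forall>j<n. j \<notin> window n k i \<longrightarrow> q ! j = p ! j) \<and> q \<noteq> p"
proof
  assume "cn_move n k p q"
  then obtain i where i: "i < n" "length p = n" "length q = n"
      "\<forall>j<n. j \<notin> window n k i \<longrightarrow> q ! j = p ! j" "\<forall>j\<in>window n k i. q ! j \<le> p ! j"
      "\<exists>j\<in>window n k i. q ! j < p ! j"
    unfolding cn_move_def by blast
  then have "q \<noteq> p" "\<forall>j<n. q ! j \<le> p ! j"
    by (metis less_irrefl, metis le_refl)
  with i show "length p = n \<and> length q = n \<and> (\<forall>j<n. q ! j \<le> p ! j) \<and>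
      (\<exists>i<n. \<forall>j<n. j \<notin> window n k i \<longrightarrow> q ! j = p ! j) \<and> q \<noteq> p"
    by blast
next
  assume weak: "length p = n \<and> length q = n \<and> (\<forall>j<n. q ! j \<le> p ! j) \<and>
      (\<exists>i<n. \<forall>j<n. j \<notin> window n k i \<longrightarrow> q ! j = p ! j) \<and> q \<noteq> p"
  then obtain i where i: "i < n" "\<forall>j<n. j \<notin> window n k i \<longrightarrow> q ! j = p ! j"
    by blast
  obtain j where "j < n" "q ! j \<noteq> p ! j"
    using weak nth_equalityI[of q p] by metis
  then have "j \<in> window n k i" "q ! j < p ! j"
    using weak i(2) by (blast, simp add: le_neq_implies_less)
  then have drop: "\<exists>j\<in>window n k i. q ! j < p ! j"
    by blast
  have "window n k i \<subseteq> {..<n}"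
    using i(1) by (auto simp: window_def)
  then have "\<forall>j\<in>window n k i. q ! j \<le> p ! j"
    using weak by blast
  then have "\<exists>i<n. (\<forall>j<n. j \<notin> window n k i \<longrightarrow> q ! j = p ! j) \<and>
      (\<forall>j\<in>window n k i. q ! j \<le> p ! j) \<and> (\<exists>j\<in>window n k i. q ! j < p ! j)"
    using i drop by (intro exI[of _ i] conjI) assumption+
  moreover have "length p = n" "length q = n"
    using weak by blast+
  ultimately show "cn_move n k p q"
    unfolding cn_move_def by (intro conjI)
qed

lemma cn_move_iff_descent:
  "cn_move 7 3 [a, b, c, d, e, f, g] [A, B, C, D, E, F, G] \<longleftrightarrow>
     descent (int a) (int b) (int c) (int d) (int e) (int f) (int g)
       (int A) (int B) (int C) (int D) (int E) (int F) (int G) \<and>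
     [A, B, C, D, E, F, G] \<noteq> [a, b, c, d, e, f, g]"
proof -
  define p q where "p = [a, b, c, d, e, f, g]" and "q = [A, B, C, D, E, F, G]"
  have "(\<forall>j<7. q ! j \<le> p ! j) \<longleftrightarrow>
      A \<le> a \<and> B \<le> b \<and> C \<le> c \<and> D \<le> d \<and> E \<le> e \<and> F \<le> f \<and> G \<le> g"
    unfolding ball_lessThan_7 p_def q_def by simp
  moreover have "(\<exists>i<7. \<forall>j<7. j \<notin> window 7 3 i \<longrightarrow> q ! j = p ! j) \<longleftrightarrow>
      D = d \<and> E = e \<and> F = f \<and> G = g \<or> A = a \<and> E = e \<and> F = f \<and> G = g \<or>
      A = a \<and> B = b \<and> F = f \<and> G = g \<or> A = a \<and> B = b \<and> C = c \<and> G = g \<or>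
      A = a \<and> B = b \<and> C = c \<and> D = d \<or> B = b \<and> C = c \<and> D = d \<and> E = e \<or>
      C = c \<and> D = d \<and> E = e \<and> F = f"
    unfolding bex_lessThan_7 ball_lessThan_7 window_7_3 p_def q_def by simp
  ultimately have "cn_move 7 3 p q \<longleftrightarrow> descent (int a) (int b) (int c) (int d) (int e) (int f) (int g)
      (int A) (int B) (int C) (int D) (int E) (int F) (int G) \<and> q \<noteq> p"
    unfolding cn_move_iff_weak_move descent_def by (simp add: p_def q_def)
  then show ?thesis
    by (simp only: p_def q_def)
qed

section \<open>Balanced positions\<close>

text \<open>The stack \<open>a\<close> is the centre, with the triples \<open>b, c, d\<close> and \<open>g, f, e\<close> going away from it on
either side. Since these triples have equal sums, \<open>a + b \<le> e + f\<close> is equivalent to its mirror image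
\<open>a + g \<le> c + d\<close>.\<close>
definition balanced :: "int \<Rightarrow> int \<Rightarrow> int \<Rightarrow> int \<Rightarrow> int \<Rightarrow> int \<Rightarrow> int \<Rightarrow> bool" where
  "balanced a b c d e f g \<longleftrightarrow>
     a \<le> b \<and> a \<le> c \<and> a \<le> d \<and> a \<le> e \<and> a \<le> f \<and> a \<le> g \<and> b + c + d = e + f + g \<and>
     a + b \<le> e + f \<and> a + min b g \<le> d + e \<and> (a + b = e + f \<or> a + min b g = d + e)"

lemma balanced_reflect: "balanced a b c d e f g \<longleftrightarrow> balanced a g f e d c b"
  unfolding balanced_def min_def by (smt (verit))

lemma balanced_translate:
  "balanced (a + t) (b + t) (c + t) (d + t) (e + t) (f + t) (g + t) \<longleftrightarrow> balanced a b c d e f g"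
  unfolding balanced_def by (simp add: algebra_simps min_add_distrib_left[symmetric])

text \<open>If \<open>b \<le> g\<close>, the two inequalities and the tightness of one of them say together that \<open>a + b\<close>
is the minimum of \<open>e + f\<close> and \<open>e + d\<close>. For \<open>g \<le> b\<close> the same holds after reflection.\<close>
lemma balanced_iff_oriented:
  "balanced a b c d e f g \<longleftrightarrow>
     a \<le> b \<and> a \<le> c \<and> a \<le> d \<and> a \<le> e \<and> a \<le> f \<and> a \<le> g \<and> b + c + d = e + f + g \<and>
     (b \<le> g \<and> a + b = e + min d f \<or> g \<le> b \<and> a + g = d + min e c)"
  unfolding balanced_def min_def by (smt (verit))

lemma balanced_iff_P73:
  "balanced (int a) (int b) (int c) (int d) (int e) (int f) (int g) \<longleftrightarrow>
     [a, b, c, d, e, f, g] \<in> P73 \<or> [a, g, f, e, d, c, b] \<in> P73"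
proof -
  have "[a, b, c, d, e, f, g] \<in> P73 \<longleftrightarrow> a \<le> b \<and> a \<le> c \<and> a \<le> d \<and> a \<le> e \<and> a \<le> f \<and> a \<le> g \<and>
      b \<le> g \<and> a + b = e + min d f \<and> b + c + d = e + f + g" for a b c d e f g :: nat
    unfolding P73_def by (simp add: eq_commute[of a] min_def)
  moreover have "int a + int b = int e + min (int d) (int f) \<longleftrightarrow> a + b = e + min d f" for a b d e f
    by linarith
  moreover have "int b + int c + int d = int e + int f + int g \<longleftrightarrow> b + c + d = e + f + g"
    by linarith
  ultimately show ?thesis
    unfolding balanced_iff_oriented of_nat_le_iff by (auto simp: add.assoc add.commute add.left_commute)
qed

definition has_balance :: "int \<Rightarrow> int \<Rightarrow> int \<Rightarrow> int \<Rightarrow> int \<Rightarrow> int \<Rightarrow> int \<Rightarrow> bool" where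
  "has_balance a b c d e f g \<longleftrightarrow>
     balanced a b c d e f g \<or> balanced b c d e f g a \<or> balanced c d e f g a b \<or>
     balanced d e f g a b c \<or> balanced e f g a b c d \<or> balanced f g a b c d e \<or>
     balanced g a b c d e f"

lemma has_balance_rotate: "has_balance a b c d e f g \<longleftrightarrow> has_balance b c d e f g a"
  unfolding has_balance_def by blast

lemma bex_dihedral_orbit:
  assumes "p \<noteq> []"
  shows "(\<exists>q\<in>dihedral_orbit p. Q q) \<longleftrightarrow>
    (\<exists>m<length p. Q (rotate m p)) \<or> (\<exists>m<length p. Q (rotate m (rev p)))"
proof -
  have orbit: "(\<exists>q\<in>dihedral_orbit p. Q q) \<longleftrightarrow>
      (\<exists>m. Q (rotate m p)) \<or> (\<exists>m. Q (rotate m (rev p)))"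
    unfolding dihedral_orbit_def by blast
  have "(\<exists>m. Q (rotate m r)) \<longleftrightarrow> (\<exists>m<length p. Q (rotate m r))" if "length r = length p" for r
    using that assms by (metis length_greater_0_conv mod_less_divisor rotate_conv_mod)
  then show ?thesis
    unfolding orbit by simp
qed

lemma has_balance_iff_orbit_meets_P73:
  "(\<exists>q\<in>dihedral_orbit [a, b, c, d, e, f, g]. q \<in> P73) \<longleftrightarrow>
     has_balance (int a) (int b) (int c) (int d) (int e) (int f) (int g)"
proof -
  define p where "p = [a, b, c, d, e, f, g]"
  have "length p = 7"
    by (simp add: p_def)
  have "(\<exists>m<7. rotate m p \<in> P73) \<longleftrightarrow>
      [a, b, c, d, e, f, g] \<in> P73 \<or> [b, c, d, e, f, g, a] \<in> P73 \<or> [c, d, e, f, g, a, b] \<in> P73 \<or>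
      [d, e, f, g, a, b, c] \<in> P73 \<or> [e, f, g, a, b, c, d] \<in> P73 \<or> [f, g, a, b, c, d, e] \<in> P73 \<or>
      [g, a, b, c, d, e, f] \<in> P73"
    unfolding bex_lessThan_7 p_def by (simp add: rotate_drop_take)
  moreover have "(\<exists>m<7. rotate m (rev p) \<in> P73) \<longleftrightarrow>
      [g, f, e, d, c, b, a] \<in> P73 \<or> [f, e, d, c, b, a, g] \<in> P73 \<or> [e, d, c, b, a, g, f] \<in> P73 \<or>
      [d, c, b, a, g, f, e] \<in> P73 \<or> [c, b, a, g, f, e, d] \<in> P73 \<or> [b, a, g, f, e, d, c] \<in> P73 \<or>
      [a, g, f, e, d, c, b] \<in> P73"
    unfolding bex_lessThan_7 p_def by (simp add: rotate_drop_take)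
  moreover have "(\<exists>q\<in>dihedral_orbit p. q \<in> P73) \<longleftrightarrow>
      (\<exists>m<7. rotate m p \<in> P73) \<or> (\<exists>m<7. rotate m (rev p) \<in> P73)"
    using bex_dihedral_orbit[of p "\<lambda>q. q \<in> P73"] \<open>length p = 7\<close> by fastforce
  ultimately show ?thesis
    unfolding has_balance_def balanced_iff_P73 p_def by argo
qed

section \<open>No move connects two balanced positions\<close>

text \<open>For a common centre the reason is visible. If the window lies in one of the triples \<open>b, c, d\<close> and
\<open>e, f, g\<close>, possibly together with the centre, then the sum of the other triple is unchanged, so
only the centre can drop, and if it does, neither inequality is tight any more. If the window meets
both triples, equal amounts are removed from them. For the window \<open>g, a, b\<close> this lowers the left-hand
sides only, and neither inequality remains tight; for \<open>c, d, e\<close> and \<open>d, e, f\<close> it lowers the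
right-hand sides only, and the inequality that was tight is violated. For the other centres the
minimality of both centres enters as well; every choice of the window leaves a linear problem.\<close>
lemma balanced_descent_near:
  assumes p: "balanced a b c d e f g" and pq: "descent a b c d e f g A B C D E F G"
    and q: "balanced A B C D E F G \<or> balanced B C D E F G A \<or> balanced C D E F G A B \<or>
      balanced D E F G A B C"
  shows "a + b + c + d + e + f + g \<le> A + B + C + D + E + F + G"
  using q
proof (elim disjE)
  assume "balanced A B C D E F G"
  with p pq show ?thesis
    unfolding balanced_def descent_def min_def by (smt (verit))
next
  assume "balanced B C D E F G A"
  with p pq show ?thesis
    unfolding balanced_def descent_def min_def by (smt (verit))
next
  assume "balanced C D E F G A B"
  with p pq show ?thesis
    unfolding balanced_def descent_def min_def by (smt (verit))
next
  assume "balanced D E F G A B C"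
  with p pq show ?thesis
    unfolding balanced_def descent_def min_def by (smt (verit))
qed

text \<open>The reflection that fixes the first centre exchanges the centres at distance \<open>j\<close> on its two sides.\<close>
lemma balanced_descent:
  assumes p: "balanced a b c d e f g" and pq: "descent a b c d e f g A B C D E F G"
    and q: "has_balance A B C D E F G"
  shows "a + b + c + d + e + f + g \<le> A + B + C + D + E + F + G"
proof -
  note mirrored = balanced_descent_near[OF p[THEN balanced_reflect[THEN iffD1]]
      pq[THEN descent_reflect[THEN iffD1]]]
  from q consider
      "balanced A B C D E F G \<or> balanced B C D E F G A \<or> balanced C D E F G A B \<or>
        balanced D E F G A B C"
    | "balanced G F E D C B A \<or> balanced F E D C B A G \<or> balanced E D C B A G F"
    unfolding has_balance_def using balanced_reflect by blast
  then show ?thesis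
  proof cases
    case 1
    then show ?thesis
      by (rule balanced_descent_near[OF p pq])
  next
    case 2
    then have "a + g + f + e + d + c + b \<le> A + G + F + E + D + C + B"
      using mirrored by blast
    then show ?thesis
      by simp
  qed
qed

lemma has_balance_descent:
  assumes "has_balance a b c d e f g" "has_balance A B C D E F G"
    and "descent a b c d e f g A B C D E F G"
  shows "a + b + c + d + e + f + g \<le> A + B + C + D + E + F + G"
proof -
  define stable where "stable a b c d e f g A B C D E F G \<longleftrightarrow>
    (has_balance A B C D E F G \<longrightarrow> descent a b c d e f g A B C D E F G \<longrightarrow>
      a + b + c + d + e + f + g \<le> A + B + C + D + E + F + G)"
    for a b c d e f g A B C D E F G
  have rotate: "stable a b c d e f g A B C D E F G" if "stable b c d e f g a B C D E F G A"
    for a b c d e f g A B C D E F G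
    using that has_balance_rotate[of A B C D E F G] descent_rotate[of a b c d e f g A B C D E F G]
    by (simp add: stable_def add_ac)
  have balanced: "stable a b c d e f g A B C D E F G" if "balanced a b c d e f g"
    for a b c d e f g A B C D E F G
    using that balanced_descent by (simp add: stable_def)
  have "stable a b c d e f g A B C D E F G"
    using assms(1) unfolding has_balance_def by (elim disjE) (blast intro: balanced rotate)+
  then show ?thesis
    using assms(2,3) by (simp add: stable_def)
qed

section \<open>Reaching a balanced position\<close>

text \<open>The centre is empty and stays so. Each leaf of the case distinction chooses values that make
one of the inequalities \<open>B \<le> E + F\<close> and \<open>min B G \<le> D + E\<close> tight; the equality of the sums of
the two triples then determines the rest. Capital letters denote
the stacks after the move.\<close>
lemma descent_to_balanced_zero:
  fixes b c d e f g :: int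
  assumes nonneg: "0 \<le> b" "0 \<le> c" "0 \<le> d" "0 \<le> e" "0 \<le> f" "0 \<le> g" and "b \<le> g"
  shows "\<exists>B C D E F G. descent 0 b c d e f g 0 B C D E F G \<and> balanced 0 B C D E F G"
proof -
  have reach: ?thesis if "descent 0 b c d e f g 0 B C D E F G" "balanced 0 B C D E F G"
    for B C D E F G
    using that by blast
  \<comment> \<open>The stack \<open>b\<close> is split as \<open>E + F\<close>, so both triples have the sum \<open>b + c + d\<close>.\<close>
  have lower_efg: ?thesis if "c + d \<le> g" "b \<le> e + f" "b \<le> d + e \<or> c \<le> e"
    by (rule reach[of b c d "min e b" "b - min e b" "c + d"])
      (use nonneg \<open>b \<le> g\<close> that in \<open>auto simp: descent_def balanced_def min_def\<close>)
  \<comment> \<open>The two sums \<open>e + f\<close> and \<open>c + d\<close> are put crosswise beside the centre.\<close>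
  have lower_gb: ?thesis if "c + d \<le> g" "e + f \<le> b" "c \<le> e \<or> f \<le> d"
    by (rule reach[of "e + f" c d e f "c + d"])
      (use nonneg \<open>b \<le> g\<close> that in \<open>auto simp: descent_def balanced_def min_def\<close>)
  show ?thesis
  proof (cases "b \<le> e + min d f")
    case True
    then have small_b: "b \<le> d + e" "b \<le> e + f"
      by linarith+
    show ?thesis
    proof (cases "c + d \<le> g")
      case True
      show ?thesis
        by (rule lower_efg) (use small_b True in linarith)+
    next
      case g_small: False
      show ?thesis
      proof (cases "g \<le> b + c \<and> g \<le> c + f")
        case near: True
        show ?thesis
        proof (cases "f + g \<le> c + 2 * min b d")
          case True
          \<comment> \<open>With \<open>D = s\<close> and \<open>E = b - s\<close> the second inequality is tight; equal sums then determine \<open>C\<close>.\<close>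
          define s where "s = min f (min b d)"
          show ?thesis
            by (rule reach[of b "f + g - 2 * s" s "b - s" f g])
              (use nonneg \<open>b \<le> g\<close> small_b near True in \<open>auto simp: s_def descent_def balanced_def min_def\<close>)
        next
          case False
          then have far: "c + 2 * b < f + g \<or> c + 2 * d < f + g"
            by linarith
          \<comment> \<open>With \<open>D = t\<close> and \<open>E = b - t\<close> the second inequality is tight; equal sums then determine \<open>F\<close>.
            The first inequality needs \<open>g - c \<le> t\<close>, and \<open>E \<le> e\<close> needs \<open>b - e \<le> t\<close>. Being minimal,
            \<open>t\<close> also keeps \<open>D \<le> d\<close> and \<open>F \<le> f\<close>, the latter because of \<open>near\<close> and \<open>far\<close>.\<close>
          define t where "t = max 0 (max (g - c) (b - e))"
          show ?thesis
            by (rule reach[of b c t "b - t" "c + 2 * t - g" g])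
              (use nonneg \<open>b \<le> g\<close> small_b g_small near far in
                \<open>auto simp: t_def descent_def balanced_def min_def max_def\<close>)
        qed
      next
        case False
        \<comment> \<open>Now \<open>c + D = g\<close>, so equal sums mean \<open>b = E + F\<close>. The height \<open>g\<close> is so large that
          \<open>F = s\<close> is \<open>f\<close> or \<open>b\<close>, whence \<open>E \<le> e\<close>.\<close>
        define s where "s = min f (min (g - c) b)"
        show ?thesis
          by (rule reach[of b c "g - c" "b - s" s g])
            (use nonneg \<open>b \<le> g\<close> small_b g_small False in \<open>auto simp: s_def descent_def balanced_def min_def\<close>)
      qed
    qed
  next
    case large_b: False
    show ?thesis
    proof (cases "f \<le> d")
      case True
      then have b_large: "e + f \<le> b"
        using large_b by linarith
      show ?thesis
      proof (cases "g \<le> c + d")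
        case g_small: True
        \<comment> \<open>With \<open>B = e + f\<close> the first inequality is tight; equal sums leave \<open>g\<close> to be split as \<open>C + D\<close>.\<close>
        define D where "D = min d g"
        show ?thesis
          by (rule reach[of "e + f" "g - D" D e f g])
            (use nonneg \<open>b \<le> g\<close> b_large True g_small in \<open>auto simp: D_def descent_def balanced_def min_def\<close>)
      next
        case False
        show ?thesis
          by (rule lower_gb) (use b_large True False in linarith)+
      qed
    next
      case False
      then have d_small: "d \<le> f" "d + e < b"
        using large_b by linarith+
      \<comment> \<open>While \<open>B = d + e\<close> is possible, it makes the second inequality tight: in the first case \<open>c\<close>
        is lowered to equate the sums, in the second case \<open>g\<close>. Afterwards \<open>g\<close> takes over the role
        of \<open>b\<close>, with \<open>G = d + min c e\<close>, and \<open>b\<close> or \<open>f\<close> is lowered to equate the sums.\<close>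
      consider
          "f + g \<le> c + 2 * d"
        | "c + 2 * d < f + g" "e + f \<le> c + d"
        | "c + d < e + f" "c \<le> e"
        | "c + d < e + f" "e < c" "2 * e + f \<le> b + c"
        | "e < c" "b + c < 2 * e + f"
        by linarith
      then show ?thesis
      proof cases
        case 1
        show ?thesis
          by (rule reach[of "e + d" "f + g - 2 * d" d e f g])
            (use nonneg \<open>b \<le> g\<close> d_small 1 in \<open>auto simp: descent_def balanced_def min_def\<close>)
      next
        case 2
        show ?thesis
          by (rule reach[of "e + d" c d e f "c + 2 * d - f"])
            (use nonneg \<open>b \<le> g\<close> d_small 2 in \<open>auto simp: descent_def balanced_def min_def\<close>)
      next
        case 3
        show ?thesis
        proof (cases "e + f \<le> b")
          case True
          show ?thesis
            by (rule lower_gb) (use d_small \<open>b \<le> g\<close> 3 True in linarith)+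
        next
          case False
          show ?thesis
            by (rule lower_efg) (use d_small \<open>b \<le> g\<close> 3 False in linarith)+
        qed
      next
        case 4
        show ?thesis
          by (rule reach[of "2 * e + f - c" c d e f "d + e"])
            (use nonneg \<open>b \<le> g\<close> d_small 4 in \<open>auto simp: descent_def balanced_def min_def\<close>)
      next
        case 5
        show ?thesis
          by (rule reach[of b c d e "b + c - 2 * e" "d + e"])
            (use nonneg \<open>b \<le> g\<close> d_small 5 in \<open>auto simp: descent_def balanced_def min_def\<close>)
      qed
    qed
  qed
qed

lemma descent_to_balanced:
  fixes a b c d e f g :: int
  assumes "a \<le> b" "a \<le> c" "a \<le> d" "a \<le> e" "a \<le> f" "a \<le> g"
  shows "\<exists>B C D E F G. descent a b c d e f g a B C D E F G \<and> balanced a B C D E F G"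
proof -
  have oriented: "\<exists>B C D E F G. descent a b c d e f g a B C D E F G \<and> balanced a B C D E F G"
    if min: "a \<le> b" "a \<le> c" "a \<le> d" "a \<le> e" "a \<le> f" "a \<le> g" and "b \<le> g" for b c d e f g
  proof -
    obtain B C D E F G where
      "descent 0 (b - a) (c - a) (d - a) (e - a) (f - a) (g - a) 0 B C D E F G" "balanced 0 B C D E F G"
      using descent_to_balanced_zero[of "b - a" "c - a" "d - a" "e - a" "f - a" "g - a"] min \<open>b \<le> g\<close>
      by auto
    then have "descent a b c d e f g a (B + a) (C + a) (D + a) (E + a) (F + a) (G + a)"
        "balanced a (B + a) (C + a) (D + a) (E + a) (F + a) (G + a)"
      using descent_translate[of a a b c d e f g 0 B C D E F G] balanced_translate[of 0 a B C D E F G]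
      by simp_all
    then show ?thesis
      by blast
  qed
  show ?thesis
  proof (cases "b \<le> g")
    case True
    then show ?thesis
      using assms by (intro oriented)
  next
    case False
    then obtain B C D E F G where "descent a g f e d c b a G F E D C B" "balanced a G F E D C B"
      using oriented[of g f e d c b] assms by auto
    then have "descent a b c d e f g a B C D E F G" "balanced a B C D E F G"
      using descent_reflect[of a b c d e f g a B C D E F G] balanced_reflect[of a B C D E F G]
      by blast+
    then show ?thesis
      by blast
  qed
qed

text \<open>Rotating a minimal stack to the front makes it the centre. Nothing becomes negative, since
the heights after the move are at least that of the centre, which is unchanged.\<close>
lemma descent_to_has_balance:
  fixes a b c d e f g :: nat
  shows "\<exists>A B C D E F G :: nat. has_balance (int A) (int B) (int C) (int D) (int E) (int F) (int G) \<and>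
    descent (int a) (int b) (int c) (int d) (int e) (int f) (int g)
      (int A) (int B) (int C) (int D) (int E) (int F) (int G)"
proof -
  define reaches :: "nat \<Rightarrow> nat \<Rightarrow> nat \<Rightarrow> nat \<Rightarrow> nat \<Rightarrow> nat \<Rightarrow> nat \<Rightarrow> bool"
    where "reaches a b c d e f g \<longleftrightarrow>
      (\<exists>A B C D E F G :: nat. has_balance (int A) (int B) (int C) (int D) (int E) (int F) (int G) \<and>
        descent (int a) (int b) (int c) (int d) (int e) (int f) (int g)
          (int A) (int B) (int C) (int D) (int E) (int F) (int G))"
    for a b c d e f g
  have rotate: "reaches a b c d e f g" if "reaches b c d e f g a" for a b c d e f g
  proof -
    from that obtain A B C D E F G :: nat where
      "has_balance (int B) (int C) (int D) (int E) (int F) (int G) (int A)"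
      "descent (int b) (int c) (int d) (int e) (int f) (int g) (int a)
        (int B) (int C) (int D) (int E) (int F) (int G) (int A)"
      unfolding reaches_def by blast
    then have "has_balance (int A) (int B) (int C) (int D) (int E) (int F) (int G)"
        "descent (int a) (int b) (int c) (int d) (int e) (int f) (int g)
          (int A) (int B) (int C) (int D) (int E) (int F) (int G)"
      using has_balance_rotate[of "int A"] descent_rotate[of "int a" "int b"] by blast+
    then show ?thesis
      unfolding reaches_def by blast
  qed
  have min_first: "reaches a b c d e f g"
    if min: "a \<le> b" "a \<le> c" "a \<le> d" "a \<le> e" "a \<le> f" "a \<le> g" for a b c d e f g :: nat
  proof -
    obtain B C D E F G where pq: "descent (int a) (int b) (int c) (int d) (int e) (int f) (int g) (int a) B C D E F G"
      and q: "balanced (int a) B C D E F G"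
      using descent_to_balanced[of "int a" "int b" "int c" "int d" "int e" "int f" "int g"] min by auto
    from q have "0 \<le> B" "0 \<le> C" "0 \<le> D" "0 \<le> E" "0 \<le> F" "0 \<le> G"
      unfolding balanced_def by simp_all
    then obtain B' C' D' E' F' G' where
      "B = int B'" "C = int C'" "D = int D'" "E = int E'" "F = int F'" "G = int G'"
      by (metis nonneg_int_cases)
    then show ?thesis
      using pq q unfolding reaches_def has_balance_def by blast
  qed
  obtain m where "m \<in> {a, b, c, d, e, f, g}" and
    min: "m \<le> a" "m \<le> b" "m \<le> c" "m \<le> d" "m \<le> e" "m \<le> f" "m \<le> g"
    using Min_in[of "{a, b, c, d, e, f, g}"] Min_le[of "{a, b, c, d, e, f, g}"] by blast
  then have "reaches a b c d e f g \<or> reaches b c d e f g a \<or> reaches c d e f g a b \<or>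
      reaches d e f g a b c \<or> reaches e f g a b c d \<or> reaches f g a b c d e \<or> reaches g a b c d e f"
    using min_first by auto
  then have "reaches a b c d e f g"
    using rotate[of b c d e f g a] rotate[of c d e f g a b] rotate[of d e f g a b c]
      rotate[of e f g a b c d] rotate[of f g a b c d e] rotate[of g a b c d e f]
    by argo
  then show ?thesis
    by (simp add: reaches_def)
qed

section \<open>The P-positions\<close>

theorem theorem5p1:
  fixes p :: "nat list"
  assumes "length p = 7"
  shows "P_position (cn_move 7 3) p \<longleftrightarrow> (\<exists>q\<in>dihedral_orbit p. q \<in> P73)"
proof (rule P_position_iff_kernel[where size_of = sum_list and S = "{p. length p = 7}"
      and K = "\<lambda>p. \<exists>q\<in>dihedral_orbit p. q \<in> P73"])
  have seven: "\<exists>a b c d e f g. p = [a, b, c, d, e, f, g]" if "length p = 7" for p :: "nat list"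
    using that by (auto simp: numeral_eq_Suc length_Suc_conv)
  have move_seven: "length p = 7 \<and> length q = 7" if "cn_move 7 3 p q" for p q
    using that by (simp add: cn_move_def)
  show "sum_list q < sum_list p" if pq: "cn_move 7 3 p q" for p q
  proof -
    obtain a b c d e f g A B C D E F G where
      "p = [a, b, c, d, e, f, g]" "q = [A, B, C, D, E, F, G]"
      using move_seven[OF pq] seven by meson
    with pq show ?thesis
      by (auto simp: cn_move_iff_descent descent_def)
  qed
  show "q \<in> {p. length p = 7}" if "cn_move 7 3 p q" for p q
    using move_seven[OF that] by simp
  show "\<not> (\<exists>r\<in>dihedral_orbit q. r \<in> P73)"
    if p: "\<exists>r\<in>dihedral_orbit p. r \<in> P73" and pq: "cn_move 7 3 p q" for p q
  proof
    assume q: "\<exists>r\<in>dihedral_orbit q. r \<in> P73"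
    obtain a b c d e f g A B C D E F G where
      eq: "p = [a, b, c, d, e, f, g]" "q = [A, B, C, D, E, F, G]"
      using move_seven[OF pq] seven by meson
    have pq': "descent (int a) (int b) (int c) (int d) (int e) (int f) (int g)
        (int A) (int B) (int C) (int D) (int E) (int F) (int G)" and "q \<noteq> p"
      using pq unfolding eq cn_move_iff_descent by blast+
    moreover have "int a + int b + int c + int d + int e + int f + int g \<le>
        int A + int B + int C + int D + int E + int F + int G"
      using has_balance_descent[OF _ _ pq'] p q unfolding eq has_balance_iff_orbit_meets_P73 by blast
    ultimately show False
      unfolding eq descent_def by auto
  qed
  show "\<exists>q. cn_move 7 3 p q \<and> (\<exists>r\<in>dihedral_orbit q. r \<in> P73)"
    if p7: "p \<in> {p. length p = 7}" and no: "\<not> (\<exists>r\<in>dihedral_orbit p. r \<in> P73)" for p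
  proof -
    obtain a b c d e f g where p: "p = [a, b, c, d, e, f, g]"
      using p7 seven by blast
    obtain A B C D E F G :: nat where reached:
      "has_balance (int A) (int B) (int C) (int D) (int E) (int F) (int G)"
      "descent (int a) (int b) (int c) (int d) (int e) (int f) (int g)
        (int A) (int B) (int C) (int D) (int E) (int F) (int G)"
      using descent_to_has_balance[of a b c d e f g] by blast
    have "[A, B, C, D, E, F, G] \<noteq> [a, b, c, d, e, f, g]"
      using no reached(1) unfolding p has_balance_iff_orbit_meets_P73 by auto
    with reached(2) have "cn_move 7 3 p [A, B, C, D, E, F, G]"
      unfolding p cn_move_iff_descent by blast
    then show ?thesis
      using reached(1) has_balance_iff_orbit_meets_P73 by blast
  qed
  show "p \<in> {p. length p = 7}"
    using assms by simp
qed

end
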